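(* Let $n\geqslant 7$ and let $\dot G=(G,\sigma)$ be an unbalanced signed graph of order $n$ that is $\mathcal{K}_4^-$-free. Then the number of edges satisfies $$e(\dot G)\leqslant \frac{n(n-1)}{2}-(n-3),$$ with equality if and only if $\dot G$ is switching equivalent (up to isomorphism) to a signed graph in the family $$\mathcal{G}=\big\{\dot G_1(a,b),\ \dot G_1'(1,n-4),\ \dot G_2(c,d),\ \dot G_3(1,n-5),\ \dot G_4(1,n-5),\ \dot G_5(1,n-5)\big\},$$ where $(a,b)$ ranges over all pairs of integers with $a+b=n-3$, $a,b\geqslant 0$, and $(c,d)$ ranges over all pairs of integers with $c+d=n-4$, $c,d\geqslant 1$.
   Context: All graphs are finite, simple and undirected. A signed graph $\dot G=(G,\sigma)$ consists of a graph $G$ (the underlying graph) and a sign function $\sigma:E(G)\to\{-1,+1\}$; its order and its number of edges $e(\dot G)$ are those of $G$. The sign of a cycle is the product of the signs of its edges; a cycle is positive or negative accordingly. $\dot G$ is balanced if all its cycles are positive, and unbalanced otherwise. For $U\subseteq V(G)$, $\dot G_U$ is obtained from $\dot G$ by reversing the sign of every edge between $U$ and $V(G)\setminus U$; $\dot G_U$ is called switching equivalent to $\dot G$, written $\dot G\sim\dot G_U$ (statements $\dot G\sim\dot H$ are understood up to sign-preserving isomorphism of signed graphs). $\mathcal{K}_4^-$ is the set of all unbalanced signed graphs whose underlying graph is $K_4$; $\dot G$ is $\mathcal{K}_4^-$-free if it contains no member of $\mathcal{K}_4^-$ as a (signed) subgraph. The signed graphs in $\mathcal{G}$, all of order $n$,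 are as follows. $\dot G_1(a,b)$, $a+b=n-3$: the vertex set is $\{u,v,w\}\cup A\cup B$ (disjoint), $|A|=a$, $|B|=b$. All pairs of vertices are adjacent except that $u$ is not adjacent to any vertex of $B$ and $v$ is not adjacent to any vertex of $A$. The edge $uv$ is negative and all other edges are positive. $\dot G_1'(1,n-4)$: same underlying graph as $\dot G_1(1,n-4)$, with $A=\{u_1\}$. The edges $uv$ and $uu_1$ are negative and all other edges are positive. $\dot G_2(c,d)$, $c+d=n-4$: the vertex set is $\{u,v,w,w_1\}\cup C\cup D$ (disjoint), $|C|=c$, $|D|=d$. All pairs of vertices are adjacent except that $w$ is not adjacent to $w_1$, $u$ is not adjacent to any vertex of $D$, and $v$ is not adjacent to any vertex of $C$. The edge $uv$ is negative and all other edges are positive. $\dot G_3(1,n-5)$, $\dot G_4(1,n-5)$, $\dot G_5(1,n-5)$: same underlying graph as $\dot G_2(1,n-5)$, with $C=\{u_1\}$. The set of negative edges is $\{uv,uu_1\}$ for $\dot G_3(1,n-5)$, $\{uv,uw_1\}$ for $\dot G_4(1,n-5)$, and $\{uv,uw_1,uu_1\}$ for $\dot G_5(1,n-5)$; all other edges are positive. *)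

theory Defs
  imports Complex_Main "HOL-Library.Ramsey"
begin

text \<open>
  Vertices may come from any type; edges are two-element sets of vertices.  The sign function is
  total on sets of vertices, but only its values on edges carry meaning.
\<close>

record 'a sgraph =
  verts :: "'a set"
  edges :: "'a set set"
  sgn_of :: "'a set \<Rightarrow> int"

definition signed_graph :: "'a sgraph \<Rightarrow> bool" where
  "signed_graph G \<longleftrightarrow>
     finite (verts G) \<and> edges G \<subseteq> nsets (verts G) 2 \<and> (\<forall>e\<in>edges G. sgn_of G e \<in> {-1, 1})"

definition cycle_edge :: "'a list \<Rightarrow> nat \<Rightarrow> 'a set" where
  "cycle_edge c i = {c ! i, c ! (Suc i mod length c)}"

definition is_cycle :: "'a sgraph \<Rightarrow> 'a list \<Rightarrow> bool" where
  "is_cycle G c \<longleftrightarrow>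
     3 \<le> length c \<and> distinct c \<and> (\<forall>i<length c. cycle_edge c i \<in> edges G)"

definition cycle_sign :: "'a sgraph \<Rightarrow> 'a list \<Rightarrow> int" where
  "cycle_sign G c = (\<Prod>i<length c. sgn_of G (cycle_edge c i))"

definition balanced :: "'a sgraph \<Rightarrow> bool" where
  "balanced G \<longleftrightarrow> (\<forall>c. is_cycle G c \<longrightarrow> cycle_sign G c = 1)"

definition switch :: "'a set \<Rightarrow> 'a sgraph \<Rightarrow> 'a sgraph" where
  "switch U G = G\<lparr>sgn_of :=
     (\<lambda>e. if \<exists>x\<in>U. \<exists>y\<in>verts G - U. e = {x, y} then - sgn_of G e else sgn_of G e)\<rparr>"

definition isomorphic :: "'a sgraph \<Rightarrow> 'b sgraph \<Rightarrow> bool" where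
  "isomorphic G H \<longleftrightarrow>
     (\<exists>f. bij_betw f (verts G) (verts H) \<and> edges H = (\<lambda>e. f ` e) ` edges G \<and>
          (\<forall>e\<in>edges G. sgn_of H (f ` e) = sgn_of G e))"

definition switching_equivalent :: "'a sgraph \<Rightarrow> 'b sgraph \<Rightarrow> bool" where
  "switching_equivalent G H \<longleftrightarrow> (\<exists>U\<subseteq>verts G. isomorphic (switch U G) H)"

definition signed_subgraph :: "'a sgraph \<Rightarrow> 'a sgraph \<Rightarrow> bool" where
  "signed_subgraph H G \<longleftrightarrow>
     verts H \<subseteq> verts G \<and> edges H \<subseteq> edges G \<and> (\<forall>e\<in>edges H. sgn_of H e = sgn_of G e)"

definition K4_minus :: "'a sgraph set" where
  "K4_minus = {H. signed_graph H \<and> card (verts H) = 4 \<and> edges H = nsets (verts H) 2 \<and>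
                  \<not> balanced H}"

definition K4_minus_free :: "'a sgraph \<Rightarrow> bool" where
  "K4_minus_free G \<longleftrightarrow> \<not> (\<exists>H\<in>K4_minus. signed_subgraph H G)"

text \<open>
  Vertices of the extremal graphs.  The vertices \<open>Vl i\<close> form the set $A$ (resp. $C$), whose
  members are not adjacent to $v$; the vertices \<open>Vr j\<close> form the set $B$ (resp. $D$), whose
  members are not adjacent to $u$.  When $A$ or $C$ is a singleton, its element $u_1$ is
  \<open>Vl 0\<close>.
\<close>

datatype vertex = Vu | Vv | Vw | Vw1 | Vl nat | Vr nat

definition graph_by_complement ::
    "'a set \<Rightarrow> 'a set set \<Rightarrow> 'a set set \<Rightarrow> 'a sgraph" where
  "graph_by_complement V nonedges negatives =
     \<lparr>verts = V, edges = nsets V 2 - nonedges, sgn_of = (\<lambda>e. if e \<in> negatives then -1 else 1)\<rparr>"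

definition G1_shape :: "nat \<Rightarrow> nat \<Rightarrow> vertex set set \<Rightarrow> vertex sgraph" where
  "G1_shape a b = graph_by_complement
     ({Vu, Vv, Vw} \<union> Vl ` {..<a} \<union> Vr ` {..<b})
     ({{Vu, Vr j} | j. j < b} \<union> {{Vv, Vl i} | i. i < a})"

definition G2_shape :: "nat \<Rightarrow> nat \<Rightarrow> vertex set set \<Rightarrow> vertex sgraph" where
  "G2_shape c d = graph_by_complement
     ({Vu, Vv, Vw, Vw1} \<union> Vl ` {..<c} \<union> Vr ` {..<d})
     ({{Vw, Vw1}} \<union> {{Vu, Vr j} | j. j < d} \<union> {{Vv, Vl i} | i. i < c})"

definition G1 :: "nat \<Rightarrow> nat \<Rightarrow> vertex sgraph" where
  "G1 a b = G1_shape a b {{Vu, Vv}}"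

definition G2 :: "nat \<Rightarrow> nat \<Rightarrow> vertex sgraph" where
  "G2 c d = G2_shape c d {{Vu, Vv}}"

text \<open>
  The first parameter of the remaining graphs is always $1$ and is omitted: the parameter \<open>b\<close>
  or \<open>d\<close> is the second one.
\<close>

definition G1' :: "nat \<Rightarrow> vertex sgraph" where
  "G1' b = G1_shape 1 b {{Vu, Vv}, {Vu, Vl 0}}"

definition G3 :: "nat \<Rightarrow> vertex sgraph" where
  "G3 d = G2_shape 1 d {{Vu, Vv}, {Vu, Vl 0}}"

definition G4 :: "nat \<Rightarrow> vertex sgraph" where
  "G4 d = G2_shape 1 d {{Vu, Vv}, {Vu, Vw1}}"

definition G5 :: "nat \<Rightarrow> vertex sgraph" where
  "G5 d = G2_shape 1 d {{Vu, Vv}, {Vu, Vw1}, {Vu, Vl 0}}"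

definition extremal_family :: "nat \<Rightarrow> vertex sgraph set" where
  "extremal_family n =
     {G1 a b | a b. a + b + 3 = n} \<union> {G1' (n - 4)} \<union>
     {G2 c d | c d. c + d + 4 = n \<and> 1 \<le> c \<and> 1 \<le> d} \<union>
     {G3 (n - 5), G4 (n - 5), G5 (n - 5)}"

end

theory Submission
  imports Defs
begin

text \<open>
  If some triangle \<open>uvw\<close> is negative, every other vertex \<open>x\<close> misses at least one vertex \<open>c x\<close> of
  the triangle, since otherwise the four of them span an unbalanced \<open>K\<^sub>4\<close>; this gives \<open>n - 3\<close>
  missing edges.  If all triangles are positive and at most \<open>n - 3\<close> edges are missing, then the
  graph is balanced, by induction: delete a vertex \<open>x\<close> and switch the rest to be all positive; the
  positive and the negative neighbours of \<open>x\<close> are mutually nonadjacent, and if there were both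
  kinds, at least \<open>n - 2\<close> edges would be missing.

  In the case of equality the missing edges are exactly the pairs \<open>{x, c x}\<close>.  One fibre of \<open>c\<close>,
  say the one over \<open>u\<close>, has at least two elements; then everything outside \<open>u\<close> can be switched to
  be positive, and the copies of \<open>K\<^sub>4\<close> through \<open>u\<close> leave only the listed signings.
\<close>

section \<open>Positive triangles, potentials and balance\<close>

text \<open>Otherwise the \<open>K4\<close> spanned by the four vertices contains
  \<open>[x, y, z]\<close> as a cycle of sign other than 1 and is a member of
  \<open>K4_minus\<close>.\<close>

lemma triangle_in_K4_positive:
  assumes G: "signed_graph G" "K4_minus_free G"
    and dist: "distinct [x, y, z, t]"
    and E: "{x, y} \<in> edges G" "{x, z} \<in> edges G" "{y, z} \<in> edges G"
      "{x, t} \<in> edges G" "{y, t} \<in> edges G" "{z, t} \<in> edges G"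
  shows "sgn_of G {x, y} * sgn_of G {y, z} * sgn_of G {x, z} = 1"
proof (rule ccontr)
  assume neg: "sgn_of G {x, y} * sgn_of G {y, z} * sgn_of G {x, z} \<noteq> 1"
  define H where "H = \<lparr>verts = {x, y, z, t}, edges = nsets {x, y, z, t} 2, sgn_of = sgn_of G\<rparr>"
  have sub: "nsets {x, y, z, t} 2 \<subseteq> edges G"
  proof
    fix e assume "e \<in> nsets {x, y, z, t} 2"
    then obtain a b where "e = {a, b}" "a \<noteq> b" "{a, b} \<subseteq> {x, y, z, t}"
      by (auto simp: nsets_def card_2_iff)
    then show "e \<in> edges G"
      using E by (auto simp: insert_commute)
  qed
  have "cycle_sign H [x, y, z] = sgn_of G {x, y} * sgn_of G {y, z} * sgn_of G {x, z}"
  proof -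
    have "{..<length [x, y, z]} = {0, 1, 2}"
      by auto
    then show ?thesis
      unfolding cycle_sign_def by (simp add: cycle_edge_def H_def insert_commute[of z])
  qed
  moreover have "is_cycle H [x, y, z]"
    unfolding is_cycle_def
  proof (intro conjI allI impI)
    fix i assume "i < length [x, y, z]"
    then consider "i = 0" | "i = 1" | "i = 2"
      by fastforce
    then show "cycle_edge [x, y, z] i \<in> edges H"
      using dist by cases (auto simp: cycle_edge_def H_def)
  qed (use dist in simp_all)
  ultimately have "\<not> balanced H"
    using neg by (auto simp: balanced_def)
  moreover have "signed_graph H"
    using G(1) sub unfolding signed_graph_def H_def by (simp add: subset_iff)
  moreover have "card (verts H) = 4"
    using distinct_card[OF dist] by (simp add: H_def)
  ultimately have "H \<in> K4_minus"
    by (simp add: K4_minus_def H_def)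
  moreover have edges: "edges G \<subseteq> nsets (verts G) 2"
    using G(1) by (simp add: signed_graph_def)
  have "{x, y} \<in> nsets (verts G) 2" "{z, t} \<in> nsets (verts G) 2"
    by (rule subsetD[OF edges E(1)], rule subsetD[OF edges E(6)])
  then have "signed_subgraph H G"
    using sub by (simp add: signed_subgraph_def H_def)
  ultimately show False
    using G(2) by (auto simp: K4_minus_free_def)
qed

text \<open>Each vertex of a cycle lies on two of its edges, so the sign of the cycle is a product
  of squares \<open>f x * f x\<close>; the cyclic shift is used to reindex one of the two
  factors.\<close>

lemma potential_imp_balanced:
  assumes G: "signed_graph G"
    and f: "\<And>x. x \<in> verts G \<Longrightarrow> f x \<in> {-1, 1}"
    and pot: "\<And>x y. {x, y} \<in> edges G \<Longrightarrow> sgn_of G {x, y} = f x * f y"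
  shows "balanced G"
  unfolding balanced_def
proof (intro allI impI)
  fix c assume c: "is_cycle G c"
  let ?k = "length c"
  have k: "?k \<ge> 3" and edge: "\<And>i. i < ?k \<Longrightarrow> {c ! i, c ! (Suc i mod ?k)} \<in> edges G"
    using c by (auto simp: is_cycle_def cycle_edge_def)
  have V: "c ! i \<in> verts G" if "i < ?k" for i
    using edge[OF that] G by (auto simp: signed_graph_def)
  have bij: "bij_betw (\<lambda>i. Suc i mod ?k) {..<?k} {..<?k}"
  proof -
    have "inj_on (\<lambda>i. Suc i mod ?k) {..<?k}"
      by (auto simp: inj_on_def mod_Suc split: if_splits)
    moreover have "(\<lambda>i. Suc i mod ?k) ` {..<?k} \<subseteq> {..<?k}"
      using k by (auto intro!: mod_less_divisor)
    ultimately show ?thesis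
      by (simp add: bij_betw_def card_image card_subset_eq)
  qed
  have "cycle_sign G c = (\<Prod>i<?k. f (c ! i) * f (c ! (Suc i mod ?k)))"
    using edge by (simp add: cycle_sign_def cycle_edge_def pot)
  also have "\<dots> = (\<Prod>i<?k. f (c ! i)) * (\<Prod>i<?k. f (c ! (Suc i mod ?k)))"
    by (rule prod.distrib)
  also have "(\<Prod>i<?k. f (c ! (Suc i mod ?k))) = (\<Prod>i<?k. f (c ! i))"
    using prod.reindex_bij_betw[OF bij, of "\<lambda>i. f (c ! i)"] by simp
  also have "(\<Prod>i<?k. f (c ! i)) * (\<Prod>i<?k. f (c ! i)) = (\<Prod>i<?k. f (c ! i) * f (c ! i))"
    by (rule prod.distrib[symmetric])
  also have "\<dots> = 1"
    using V f by (intro prod.neutral) fastforce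
  finally show "cycle_sign G c = 1" .
qed

text \<open>A potential \<open>f\<close> is a switching that makes all edges inside \<open>V\<close>
  positive. The edge set \<open>E\<close> stays fixed while \<open>V\<close> shrinks, so the
  hypotheses on edges and triangles carry over to every stage of the induction.\<close>

lemma potential_exists:
  fixes s :: "'a set \<Rightarrow> int"
  assumes "finite V"
    and E: "\<And>e. e \<in> E \<Longrightarrow> card e = 2"
    and s: "\<And>e. e \<in> E \<Longrightarrow> s e \<in> {-1, 1}"
    and tri: "\<And>x y z. {x, y} \<in> E \<Longrightarrow> {y, z} \<in> E \<Longrightarrow> {x, z} \<in> E \<Longrightarrow>
      s {x, y} * s {y, z} * s {x, z} = 1"
    and "card (nsets V 2 - E) + 3 \<le> card V"
  shows "\<exists>f. (\<forall>x\<in>V. f x \<in> {-1, 1}) \<and>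
    (\<forall>x\<in>V. \<forall>y\<in>V. {x, y} \<in> E \<longrightarrow> s {x, y} = f x * f y)"
  using assms(1,5)
proof (induction V rule: finite_psubset_induct)
  case (psubset V)
  have neq: "x \<noteq> y" if "{x, y} \<in> E" for x y
    using E[OF that] by auto
  let ?M = "nsets V 2 - E"
  have finM: "finite ?M"
    using psubset.hyps by (simp add: finite_imp_finite_nsets)
  show ?case
  \<comment> \<open>If some vertex is adjacent to all others, the potential is read off from the
    signs at that vertex. Otherwise every vertex is on a missing edge, which is what makes the
    induction step possible.\<close>
  proof (cases "\<exists>u\<in>V. \<forall>x\<in>V - {u}. {u, x} \<in> E")
    case True
    then obtain u where u: "u \<in> V" "\<And>x. x \<in> V \<Longrightarrow> x \<noteq> u \<Longrightarrow> {u, x} \<in> E"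
      by auto
    define f where "f = (\<lambda>x. if x = u then 1 else s {u, x})"
    have f: "f x \<in> {-1, 1}" if "x \<in> V" for x
      using s[OF u(2)[OF that]] by (auto simp: f_def)
    have "s {x, y} = f x * f y" if "x \<in> V" "y \<in> V" "{x, y} \<in> E" for x y
    proof (cases "x = u \<or> y = u")
      case True
      then show ?thesis
        using neq[OF that(3)] by (auto simp: f_def insert_commute)
    next
      case False
      then have "f x * s {x, y} * f y = 1"
        using tri[of u x y] u that by (auto simp: f_def)
      then show ?thesis
        using f[OF that(1)] f[OF that(2)] by auto
    qed
    then show ?thesis
      using f by blast
  next
    case False
    have "card V \<noteq> 0"
      using psubset.prems by linarith
    then obtain x where x: "x \<in> V"
      by fastforce
    then obtain y where y: "y \<in> V" "y \<noteq> x" "{x, y} \<notin> E"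
      using False by auto
    let ?W = "V - {x}"
    \<comment> \<open>Deleting \<open>x\<close> removes one vertex and at least the missing edge
      \<open>{x, y}\<close>, so the gap of 3 in the hypothesis is preserved.\<close>
    have "nsets ?W 2 - E \<subset> ?M"
    proof
      show "nsets ?W 2 - E \<subseteq> ?M"
        by (auto simp: nsets_def)
      show "nsets ?W 2 - E \<noteq> ?M"
      proof -
        have "{x, y} \<in> ?M" "{x, y} \<notin> nsets ?W 2 - E"
          using x y by simp_all
        then show ?thesis
          by metis
      qed
    qed
    then have "card (nsets ?W 2 - E) < card ?M"
      by (rule psubset_card_mono[OF finM])
    moreover have cW: "card V = Suc (card ?W)"
      using card_Suc_Diff1[OF psubset.hyps x] by simp
    ultimately have "card (nsets ?W 2 - E) + 3 \<le> card ?W"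
      using psubset.prems by linarith
    moreover have "?W \<subset> V"
      using x by blast
    ultimately have "\<exists>f. (\<forall>x\<in>?W. f x \<in> {-1, 1}) \<and>
        (\<forall>x\<in>?W. \<forall>y\<in>?W. {x, y} \<in> E \<longrightarrow> s {x, y} = f x * f y)"
      by (intro psubset.IH)
    then obtain f where f: "\<And>y. y \<in> ?W \<Longrightarrow> f y \<in> {-1, 1}"
      and pot: "\<And>y z. y \<in> ?W \<Longrightarrow> z \<in> ?W \<Longrightarrow> {y, z} \<in> E \<Longrightarrow> s {y, z} = f y * f z"
      by blast
    \<comment> \<open>\<open>P\<close> and \<open>Q\<close> are the positive and the negative
      neighbours of \<open>x\<close> once the rest has been switched by \<open>f\<close>. An edge
      between them would close a negative triangle with \<open>x\<close>.\<close>
    define P where "P = {y \<in> ?W. {x, y} \<in> E \<and> s {x, y} = f y}"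
    define Q where "Q = {y \<in> ?W. {x, y} \<in> E \<and> s {x, y} = - f y}"
    have disj: "P \<inter> Q = {}" and sub: "P \<subseteq> ?W" "Q \<subseteq> ?W"
      using f by (fastforce simp: P_def Q_def)+
    have PQ: "y \<in> P \<or> y \<in> Q" if "y \<in> ?W" "{x, y} \<in> E" for y
      using f[OF that(1)] s[OF that(2)] that by (auto simp: P_def Q_def)
    have nonadj: "{p, q} \<notin> E" if "p \<in> P" "q \<in> Q" for p q
    proof
      assume pq: "{p, q} \<in> E"
      have "s {x, p} * s {p, q} * s {x, q} = 1"
        using tri[of x p q] that pq by (auto simp: P_def Q_def)
      moreover have "s {p, q} = f p * f q"
        using pot that pq sub by blast
      ultimately show False
        using that f[of p] f[of q] by (auto simp: P_def Q_def)
    qed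
    have "P = {} \<or> Q = {}"
    proof (rule ccontr)
      assume "\<not> ?thesis"
      then obtain p q where p: "p \<in> P" and q: "q \<in> Q"
        by blast
      then have pq: "p \<in> ?W" "q \<in> ?W" "p \<notin> Q" "q \<notin> P"
        using sub disj by blast+
      \<comment> \<open>This assigns a missing edge to every vertex except \<open>x\<close> and
        \<open>p\<close>; \<open>p\<close> is left out because \<open>{p, q}\<close> is already the
        image of \<open>q\<close>. Injectivity then gives \<open>card V - 2\<close> missing edges,
        one more than allowed.\<close>
      define \<phi> where "\<phi> = (\<lambda>y. if y \<in> Q then {p, y} else if y \<in> P then {y, q} else {x, y})"
      have "\<phi> ` (?W - {p}) \<subseteq> ?M"
      proof
        fix e assume "e \<in> \<phi> ` (?W - {p})"
        then obtain y where y: "y \<in> ?W" "y \<noteq> p" "e = \<phi> y"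
          by auto
        consider "y \<in> Q" | "y \<in> P" "y \<notin> Q" | "y \<notin> P" "y \<notin> Q"
          by blast
        then show "e \<in> ?M"
        proof cases
          case 1
          then show ?thesis
            using nonadj[OF p 1] pq y by (simp add: \<phi>_def)
        next
          case 2
          then have "y \<noteq> q"
            using q by blast
          then show ?thesis
            using nonadj[OF 2(1) q] 2 pq y by (simp add: \<phi>_def)
        next
          case 3
          then have "\<phi> y = {x, y}"
            by (simp only: \<phi>_def if_False)
          then show ?thesis
            using 3 PQ[of y] y x by auto
        qed
      qed
      moreover have "inj_on \<phi> (?W - {p})"
        unfolding inj_on_def
      proof (intro ballI impI)
        fix y z assume "y \<in> ?W - {p}" "z \<in> ?W - {p}" "\<phi> y = \<phi> z"
        moreover have "y \<notin> P \<or> y \<notin> Q" "z \<notin> P \<or> z \<notin> Q"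
          using disj by blast+
        ultimately show "y = z"
          using pq unfolding \<phi>_def
          by (simp add: doubleton_eq_iff split: if_splits) metis+
      qed
      ultimately have "card (?W - {p}) \<le> card ?M"
        using card_inj_on_le finM by blast
      moreover have "card (?W - {p}) = card ?W - 1"
        using p sub by (simp add: subset_iff card_Diff_singleton)
      ultimately show False
        using psubset.prems cW by linarith
    qed
    \<comment> \<open>All neighbours of \<open>x\<close> are now of one kind, so a single sign
      \<open>c\<close> at \<open>x\<close> extends the potential.\<close>
    then obtain c :: int where c: "c \<in> {-1, 1}"
      "\<And>y. y \<in> ?W \<Longrightarrow> {x, y} \<in> E \<Longrightarrow> s {x, y} = c * f y"
    proof
      assume "P = {}"
      then show ?thesis
        using that[of "-1"] PQ by (auto simp: Q_def)
    next
      assume "Q = {}"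
      then show ?thesis
        using that[of 1] PQ by (auto simp: P_def)
    qed
    define g where "g = f(x := c)"
    have "s {y, z} = g y * g z" if "y \<in> V" "z \<in> V" "{y, z} \<in> E" for y z
      using neq[OF that(3)] c(2)[of y] c(2)[of z] pot[of y z] that
      by (auto simp: g_def insert_commute)
    moreover have "g y \<in> {-1, 1}" if "y \<in> V" for y
      using that f c(1) by (auto simp: g_def)
    ultimately show ?thesis
      by blast
  qed
qed

section \<open>Missing edges forced by a negative triangle\<close>

text \<open>A vertex adjacent to all of \<open>u\<close>, \<open>v\<close>, \<open>w\<close> would
  complete a \<open>K4\<close> around a negative triangle. The chosen pairs are distinct because
  \<open>x\<close> is the only element of \<open>{x, c x}\<close> outside the triangle.\<close>

lemma negative_triangle_nonneighbours:
  assumes G: "signed_graph G" "K4_minus_free G"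
    and E: "{u, v} \<in> edges G" "{v, w} \<in> edges G" "{u, w} \<in> edges G"
    and neg: "sgn_of G {u, v} * sgn_of G {v, w} * sgn_of G {u, w} \<noteq> 1"
  obtains c where "c ` (verts G - {u, v, w}) \<subseteq> {u, v, w}"
    "(\<lambda>x. {x, c x}) ` (verts G - {u, v, w}) \<subseteq> nsets (verts G) 2 - edges G"
    "inj_on (\<lambda>x. {x, c x}) (verts G - {u, v, w})"
proof -
  have sub: "edges G \<subseteq> nsets (verts G) 2"
    using G(1) by (simp add: signed_graph_def)
  have V: "u \<in> verts G" "v \<in> verts G" "w \<in> verts G" "u \<noteq> v" "v \<noteq> w" "u \<noteq> w"
    using subsetD[OF sub E(1)] subsetD[OF sub E(2)] subsetD[OF sub E(3)] by auto
  have "\<forall>x \<in> verts G - {u, v, w}. \<exists>y. y \<in> {u, v, w} \<and> {x, y} \<notin> edges G"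
  proof (intro ballI, rule ccontr)
    fix x assume x: "x \<in> verts G - {u, v, w}"
      and "\<nexists>y. y \<in> {u, v, w} \<and> {x, y} \<notin> edges G"
    then have "{u, x} \<in> edges G" "{v, x} \<in> edges G" "{w, x} \<in> edges G"
      by (auto simp: insert_commute)
    then have "sgn_of G {u, v} * sgn_of G {v, w} * sgn_of G {u, w} = 1"
      using V x by (intro triangle_in_K4_positive[OF G, where t = x] E) auto
    then show False
      using neg by contradiction
  qed
  then obtain c where c: "\<And>x. x \<in> verts G - {u, v, w} \<Longrightarrow> c x \<in> {u, v, w} \<and> {x, c x} \<notin> edges G"
    by (metis (no_types, lifting))
  show thesis
  proof
    show "c ` (verts G - {u, v, w}) \<subseteq> {u, v, w}"
      using c by blast
    show "(\<lambda>x. {x, c x}) ` (verts G - {u, v, w}) \<subseteq> nsets (verts G) 2 - edges G"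
    proof (rule image_subsetI)
      fix x assume x: "x \<in> verts G - {u, v, w}"
      then have "c x \<in> verts G" "x \<noteq> c x"
        using c[OF x] V by auto
      then show "{x, c x} \<in> nsets (verts G) 2 - edges G"
        using c[OF x] x by simp
    qed
    show "inj_on (\<lambda>x. {x, c x}) (verts G - {u, v, w})"
    proof (rule inj_onI)
      fix x y assume "x \<in> verts G - {u, v, w}" "y \<in> verts G - {u, v, w}" "{x, c x} = {y, c y}"
      then show "x = y"
        using c[of x] c[of y] unfolding doubleton_eq_iff by blast
    qed
  qed
qed

section \<open>Transport along vertex bijections and switching\<close>

text \<open>The two \<open>Pow\<close> hypotheses are there because taking images under
  \<open>g\<close> is injective on sets of vertices of \<open>K\<close>: images then commute with
  set difference, and membership in \<open>N\<close> can be tested after relabelling.\<close>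

lemma isomorphic_graph_by_complement:
  assumes edges: "edges K = nsets (verts K) 2 - M" and M: "M \<subseteq> Pow (verts K)"
    and N: "N \<subseteq> Pow (verts K)" "\<And>e. e \<in> edges K \<Longrightarrow> sgn_of K e = (if e \<in> N then -1 else 1)"
    and g: "bij_betw g (verts K) V"
  shows "isomorphic K (graph_by_complement V ((`) g ` M) ((`) g ` N))"
  unfolding isomorphic_def
proof (intro exI[of _ g] conjI ballI)
  have inj: "inj_on ((`) g) (Pow (verts K))"
    using g by (simp add: bij_betw_def inj_on_image_Pow)
  have sub: "nsets (verts K) 2 \<subseteq> Pow (verts K)"
    by (auto simp: nsets_def)
  have "(`) g ` nsets (verts K) 2 = nsets V 2"
    using bij_betw_nsets[OF g, of 2] by (simp add: bij_betw_def)
  then show "edges (graph_by_complement V ((`) g ` M) ((`) g ` N)) = (`) g ` edges K"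
    using inj_on_image_set_diff[OF inj _ M, of "nsets (verts K) 2"] sub
    by (simp add: edges graph_by_complement_def Diff_subset subset_trans[OF Diff_subset])
  show "bij_betw g (verts K) (verts (graph_by_complement V ((`) g ` M) ((`) g ` N)))"
    using g by (simp add: graph_by_complement_def)
  fix e assume e: "e \<in> edges K"
  then have "e \<in> Pow (verts K)"
    using sub edges by blast
  then have "g ` e \<in> (`) g ` N \<longleftrightarrow> e \<in> N"
    using inj_on_image_mem_iff[OF inj _ N(1)] by blast
  then show "sgn_of (graph_by_complement V ((`) g ` M) ((`) g ` N)) (g ` e) = sgn_of K e"
    using N(2)[OF e] by (simp add: graph_by_complement_def)
qed

text \<open>An edge crosses the switching set exactly if \<open>f x\<close> and \<open>f y\<close>
  differ, that is, if \<open>f x * f y\<close> is -1.\<close>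

lemma sgn_of_switch:
  assumes f: "\<And>x. x \<in> verts G \<Longrightarrow> f x \<in> {-1, 1 :: int}" and xy: "x \<in> verts G" "y \<in> verts G"
  shows "sgn_of (switch {x \<in> verts G. f x = -1} G) {x, y} = f x * f y * sgn_of G {x, y}"
proof -
  have "(\<exists>a\<in>{x \<in> verts G. f x = -1}. \<exists>b\<in>verts G - {x \<in> verts G. f x = -1}. {x, y} = {a, b})
      \<longleftrightarrow> f x \<noteq> f y"
  proof
    assume "f x \<noteq> f y"
    then have "f x = -1 \<and> f y \<noteq> -1 \<or> f x \<noteq> -1 \<and> f y = -1"
      using f[OF xy(1)] f[OF xy(2)] by auto
    then show "\<exists>a\<in>{x \<in> verts G. f x = -1}. \<exists>b\<in>verts G - {x \<in> verts G. f x = -1}. {x, y} = {a, b}"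
      using xy by (auto simp: insert_commute)
  qed (auto simp: doubleton_eq_iff)
  then show ?thesis
    using f[OF xy(1)] f[OF xy(2)] by (auto simp: switch_def)
qed

lemma card_ge_2_other:
  assumes "2 \<le> card A"
  shows "\<exists>y\<in>A. y \<noteq> x"
proof (rule ccontr)
  assume "\<not> ?thesis"
  then have "A \<subseteq> {x}"
    by blast
  then show False
    using card_mono[of "{x}" A] assms by simp
qed

section \<open>Structure of the graphs attaining the bound\<close>

text \<open>The situation of equality around a negative triangle. \<open>large\<close> and
  \<open>small\<close> only fix the names of its three vertices: some fibre of \<open>c\<close> has
  two elements, and the other two fibres are put in order.\<close>

locale extremal_triangle =
  fixes G :: "'a sgraph" and u v w :: 'a and c :: "'a \<Rightarrow> 'a"
  assumes signed: "signed_graph G" and free: "K4_minus_free G"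
    and uv: "{u, v} \<in> edges G" and vw: "{v, w} \<in> edges G" and uw: "{u, w} \<in> edges G"
    and negative: "sgn_of G {u, v} * sgn_of G {v, w} * sgn_of G {u, w} = -1"
    and c: "c ` (verts G - {u, v, w}) \<subseteq> {u, v, w}"
    and nonedges: "nsets (verts G) 2 - edges G = (\<lambda>x. {x, c x}) ` (verts G - {u, v, w})"
    and order: "7 \<le> card (verts G)"
    and large: "2 \<le> card {x \<in> verts G - {u, v, w}. c x = u}"
    and small: "card {x \<in> verts G - {u, v, w}. c x = w} \<le> card {x \<in> verts G - {u, v, w}. c x = v}"
begin

definition R :: "'a set" where
  "R = verts G - {u, v, w}"

definition nonadj :: "'a \<Rightarrow> 'a set" where
  "nonadj y = {x \<in> R. c x = y}"

definition adj :: "'a \<Rightarrow> 'a \<Rightarrow> bool" where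
  "adj x y \<longleftrightarrow> {x, y} \<in> edges G"

lemma edges_subset: "edges G \<subseteq> nsets (verts G) 2"
  using signed by (simp add: signed_graph_def)

lemma finite_verts: "finite (verts G)"
  using signed by (simp add: signed_graph_def)

lemma finite_R: "finite R"
  using finite_verts by (simp add: R_def)

lemma finite_nonadj: "finite (nonadj y)"
  using finite_R by (simp add: nonadj_def)

lemma adj_verts: "adj x y \<Longrightarrow> x \<in> verts G \<and> y \<in> verts G \<and> x \<noteq> y"
  using subsetD[OF edges_subset, of "{x, y}"] by (simp add: adj_def)

lemma adj_sym: "adj x y \<longleftrightarrow> adj y x"
  by (simp add: adj_def insert_commute)

lemma triangle_verts: "u \<in> verts G" "v \<in> verts G" "w \<in> verts G" "u \<noteq> v" "v \<noteq> w" "u \<noteq> w"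
  using adj_verts[of u v] adj_verts[of v w] adj_verts[of u w] uv vw uw by (auto simp: adj_def)

lemma c_cases: "x \<in> R \<Longrightarrow> c x = u \<or> c x = v \<or> c x = w"
  using c by (auto simp: R_def)

text \<open>Since \<open>nonedges\<close> is an equality, adjacency is completely determined by
  \<open>c\<close>; later adjacency claims are reduced to cases on the values of
  \<open>c\<close>.\<close>

lemma adj_iff:
  "adj x y \<longleftrightarrow>
    x \<in> verts G \<and> y \<in> verts G \<and> x \<noteq> y \<and> \<not> (x \<in> R \<and> y = c x) \<and> \<not> (y \<in> R \<and> x = c y)"
proof -
  have "{x, y} \<in> nsets (verts G) 2 - edges G \<longleftrightarrow> (x \<in> R \<and> y = c x) \<or> (y \<in> R \<and> x = c y)"
    unfolding nonedges R_def image_iff doubleton_eq_iff by auto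
  then show ?thesis
    using adj_verts[of x y] by (auto simp: adj_def)
qed

lemma card_R: "card (verts G) = card R + 3"
proof -
  have "card {u, v, w} = 3"
    using triangle_verts by simp
  moreover have "card {u, v, w} \<le> card (verts G)"
    using triangle_verts finite_verts by (intro card_mono) auto
  ultimately show ?thesis
    using triangle_verts finite_verts by (simp add: R_def card_Diff_subset)
qed

lemma R_eq: "R = nonadj u \<union> nonadj v \<union> nonadj w"
  using c_cases by (auto simp: nonadj_def)

lemma card_R_eq: "card R = card (nonadj u) + card (nonadj v) + card (nonadj w)"
proof -
  have "nonadj u \<inter> nonadj v = {}" "(nonadj u \<union> nonadj v) \<inter> nonadj w = {}"
    using triangle_verts by (auto simp: nonadj_def)
  then show ?thesis
    by (simp add: R_eq card_Un_disjoint finite_nonadj)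
qed

text \<open>Here \<open>f x * f y * sgn_of G {x, y}\<close> is the sign of \<open>xy\<close> after
  switching the set where \<open>f\<close> is -1. Thus only edges at \<open>u\<close> may stay
  negative, and the signs of \<open>uv\<close> and \<open>uw\<close> are prescribed as in the
  extremal graphs.\<close>

definition normalising :: "('a \<Rightarrow> int) \<Rightarrow> bool" where
  "normalising f \<longleftrightarrow> (\<forall>x\<in>verts G. f x \<in> {-1, 1}) \<and>
    (\<forall>x y. adj x y \<and> x \<noteq> u \<and> y \<noteq> u \<longrightarrow> f x * f y * sgn_of G {x, y} = 1) \<and>
    f u * f w * sgn_of G {u, w} = 1 \<and> f u * f v * sgn_of G {u, v} = -1"

lemma sign_values: "adj x y \<Longrightarrow> sgn_of G {x, y} = 1 \<or> sgn_of G {x, y} = -1"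
  using signed by (auto simp: signed_graph_def adj_def)

text \<open>Switching preserves the sign of a triangle, as every value of \<open>f\<close> enters
  squared.\<close>

lemma K4_positive:
  assumes f: "\<And>x. x \<in> verts G \<Longrightarrow> f x \<in> {-1, 1 :: int}"
    and E: "adj x y" "adj x z" "adj y z" "adj x t" "adj y t" "adj z t"
  shows "(f x * f y * sgn_of G {x, y}) * (f y * f z * sgn_of G {y, z}) *
    (f x * f z * sgn_of G {x, z}) = 1"
proof -
  have "sgn_of G {x, y} * sgn_of G {y, z} * sgn_of G {x, z} = 1"
    using E adj_verts by (intro triangle_in_K4_positive[OF signed free, where t = t])
      (auto simp: adj_def)
  moreover have "f x * f x = 1" "f y * f y = 1" "f z * f z = 1"
    using f[of x] f[of y] f[of z] E(1,3) adj_verts by auto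
  moreover have "(f x * f y * sgn_of G {x, y}) * (f y * f z * sgn_of G {y, z}) *
      (f x * f z * sgn_of G {x, z}) =
      (f x * f x) * (f y * f y) * (f z * f z) * (sgn_of G {x, y} * sgn_of G {y, z} * sgn_of G {x, z})"
    by (simp only: mult_ac)
  ultimately show ?thesis
    by simp
qed

text \<open>Fix a vertex \<open>z \<in> nonadj u\<close>, and switch so that all edges at \<open>z\<close> become positive.
  Every edge \<open>xy\<close> of \<open>G - u\<close> forms a triangle with \<open>z\<close> that lies in a \<open>K\<^sub>4\<close>, so it is
  then positive, too.\<close>

lemma normalising_exists: "\<exists>f. normalising f"
proof -
  have "2 \<le> card (nonadj u)"
    using large by (simp add: nonadj_def R_def)
  then obtain z z' where z: "z \<in> nonadj u" "z' \<in> nonadj u" "z \<noteq> z'"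
    using card_ge_2_other by metis
  have zR: "z \<in> R" "c z = u" "z' \<in> R" "c z' = u"
    using z by (auto simp: nonadj_def)
  have R_not: "x \<noteq> u \<and> x \<noteq> v \<and> x \<noteq> w \<and> x \<in> verts G" if "x \<in> R" for x
    using that by (auto simp: R_def)
  \<comment> \<open>The values of \<open>c\<close> lie in the triangle, so the only missing edge at
    a vertex of \<open>R\<close> is the one to its own value of \<open>c\<close>.\<close>
  have z_adj: "adj z x" if "x \<in> verts G" "x \<noteq> z" "x \<noteq> u" for x
    using that zR R_not[of z] c_cases[of x] by (auto simp: adj_iff)
  have z'_adj: "adj z' x" if "x \<in> verts G" "x \<noteq> z'" "x \<noteq> u" for x
    using that zR R_not[of z'] c_cases[of x] by (auto simp: adj_iff)
  \<comment> \<open>The case \<open>x = z\<close> is separate because \<open>sgn_of G {z, z}\<close> is arbitrary.\<close>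
  define f' where "f' = (\<lambda>x. if x = z then 1 else sgn_of G {z, x})"
  \<comment> \<open>As \<open>z\<close> and \<open>u\<close> are not adjacent, the value at
    \<open>u\<close> is still free; it is chosen to make \<open>uw\<close> positive.\<close>
  define f where "f = (\<lambda>x. if x = u then f' w * sgn_of G {u, w} else f' x)"
  have f': "f' x \<in> {-1, 1}" if "x \<in> verts G" "x \<noteq> u" for x
    using sign_values[OF z_adj[OF that(1) _ that(2)]] by (auto simp: f'_def)
  have f: "f x \<in> {-1, 1}" if "x \<in> verts G" for x
    using f'[OF that] f'[of w] triangle_verts sign_values[of u w] uw by (auto simp: f_def adj_def)
  have base: "f z * f x * sgn_of G {z, x} = 1" if "adj z x" "x \<noteq> u" for x
    using adj_verts[OF that(1)] sign_values[OF that(1)] that zR R_not[of z]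
    by (auto simp: f_def f'_def)
  \<comment> \<open>The fourth vertex of a \<open>K4\<close> on \<open>z\<close>, \<open>x\<close>,
    \<open>y\<close> is the other one of \<open>v\<close> and \<open>w\<close> if \<open>y\<close>
    misses \<open>u\<close>; if \<open>y\<close> misses that vertex, it is \<open>z'\<close>, the
    second nonneighbour of \<open>u\<close>.\<close>
  have fourth: "\<exists>q. adj z q \<and> adj x q \<and> adj y q"
    if x: "x \<in> {v, w}" and y: "y \<in> R" and xy: "adj x y" "y \<noteq> z" for x y
  proof -
    obtain x' where x': "x' \<in> {v, w}" "x' \<noteq> x"
      using x triangle_verts by auto
    have "c y \<noteq> x"
      using xy y by (auto simp: adj_iff)
    then consider "c y = u" | "c y = x'"
      using c_cases[OF y] x x' by auto
    then show ?thesis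
    proof cases
      case 1
      have "adj x x'"
        using x x' vw by (auto simp: adj_def insert_commute)
      moreover have "adj z x'"
        using x' triangle_verts R_not[OF zR(1)] by (intro z_adj) auto
      moreover have "adj y x'"
        using 1 y x' triangle_verts R_not[OF y] by (auto simp: adj_iff R_def)
      ultimately show ?thesis
        by blast
    next
      case 2
      have "adj z z'"
        using z zR R_not[OF zR(3)] by (intro z_adj) auto
      moreover have "adj z' x"
        using x triangle_verts R_not[OF zR(3)] by (intro z'_adj) auto
      moreover have "adj z' y"
        using 2 x' zR triangle_verts R_not[OF y] by (intro z'_adj) auto
      ultimately show ?thesis
        using adj_sym by blast
    qed
  qed
  have R_adj: "adj x y" if "x \<in> R" "y \<in> R" "x \<noteq> y" for x y
    using that R_not[of x] R_not[of y] c_cases[of x] c_cases[of y] by (auto simp: adj_iff)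
  have pos: "f x * f y * sgn_of G {x, y} = 1" if xy: "adj x y" and nu: "x \<noteq> u" "y \<noteq> u" for x y
  proof (cases "x = z \<or> y = z")
    case True
    then show ?thesis
      using base[of x] base[of y] xy nu adj_sym by (auto simp: insert_commute mult_ac)
  next
    case False
    have V: "x \<in> verts G" "y \<in> verts G" "x \<noteq> y"
      using adj_verts[OF xy] by auto
    have "\<exists>q. adj z q \<and> adj x q \<and> adj y q"
    proof (cases "x \<in> R")
      case xR: True
      show ?thesis
      proof (cases "y \<in> R")
        case yR: True
        \<comment> \<open>\<open>R\<close> is a clique with at least four vertices because the order
          is at least 7, so a further vertex \<open>q\<close> remains.\<close>
        have "card {x, y, z} < card R"
          using card_R order card_length[of "[x, y, z]"] by simp
        then obtain q where "q \<in> R" "q \<notin> {x, y, z}"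
          using card_mono[of "{x, y, z}" R] by fastforce
        then show ?thesis
          using R_adj xR yR zR(1) by blast
      next
        case False
        then show ?thesis
          using fourth[of y x] xR xy V nu \<open>\<not> (x = z \<or> y = z)\<close> adj_sym by (auto simp: R_def)
      qed
    next
      case xR: False
      then have x: "x \<in> {v, w}"
        using V nu by (auto simp: R_def)
      show ?thesis
      proof (cases "y \<in> R")
        case True
        then show ?thesis
          using fourth[OF x True xy] False by blast
      next
        case yR: False
        then have "y \<in> {v, w}"
          using V nu by (auto simp: R_def)
        moreover have "adj z z'"
          using z zR R_not[OF zR(3)] by (intro z_adj) auto
        moreover have "adj z' v" "adj z' w"
          using triangle_verts R_not[OF zR(3)] by (auto intro!: z'_adj)
        ultimately show ?thesis
          using x adj_sym by blast
      qed
    qed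
    then obtain q where q: "adj z q" "adj x q" "adj y q"
      by blast
    have zx: "adj z x" and zy: "adj z y"
      using False V nu by (auto intro: z_adj)
    show ?thesis
      using K4_positive[of f z x y q, OF f zx zy xy q] base[OF zx nu(1)] base[OF zy nu(2)] by simp
  qed
  have uw1: "f u * f w * sgn_of G {u, w} = 1"
    using f'[of w] triangle_verts sign_values[of u w] uw by (auto simp: f_def adj_def)
  have "f v * f w * sgn_of G {v, w} = 1"
    using pos[of v w] vw triangle_verts by (auto simp: adj_def)
  \<comment> \<open>The triangle stays negative after switching, and \<open>uw\<close> and
    \<open>vw\<close> are positive; hence \<open>uv\<close> must be negative.\<close>
  moreover have "(f u * f w * sgn_of G {u, w}) * (f v * f w * sgn_of G {v, w}) *
      (f u * f v * sgn_of G {u, v}) = -1"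
  proof -
    have "f u * f u = 1" "f v * f v = 1" "f w * f w = 1"
      using f[of u] f[of v] f[of w] triangle_verts by auto
    moreover have "(f u * f w * sgn_of G {u, w}) * (f v * f w * sgn_of G {v, w}) *
        (f u * f v * sgn_of G {u, v}) = (f u * f u) * (f v * f v) * (f w * f w) *
        (sgn_of G {u, v} * sgn_of G {v, w} * sgn_of G {u, w})"
      by (simp only: mult_ac)
    ultimately show ?thesis
      by (simp add: negative)
  qed
  ultimately have "f u * f v * sgn_of G {u, v} = -1"
    using uw1 by simp
  then show ?thesis
    using f pos uw1 unfolding normalising_def by blast
qed

text \<open>Every claim comes from a \<open>K4\<close> through \<open>u\<close> that contains two
  vertices of one fibre of \<open>c\<close>; its edges away from \<open>u\<close> are positive, so
  its edges at \<open>u\<close> have equal signs.\<close>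

lemma normalising_large:
  assumes f: "normalising f" and two: "2 \<le> card (nonadj v)"
  shows "card (nonadj w) \<le> 1" "\<And>x. x \<in> nonadj v \<union> nonadj w \<Longrightarrow> f u * f x * sgn_of G {u, x} = 1"
proof -
  have val: "\<And>x. x \<in> verts G \<Longrightarrow> f x \<in> {-1, 1}"
    and pos: "\<And>x y. adj x y \<Longrightarrow> x \<noteq> u \<Longrightarrow> y \<noteq> u \<Longrightarrow> f x * f y * sgn_of G {x, y} = 1"
    and uw1: "f u * f w * sgn_of G {u, w} = 1" and uv1: "f u * f v * sgn_of G {u, v} = -1"
    using f unfolding normalising_def by auto
  have adjs: "adj u v" "adj u w"
    using uv uw by (auto simp: adj_def)
  have nonadj: "x \<in> R" "x \<noteq> u" "x \<noteq> v" "x \<noteq> w" "x \<in> verts G" "c x = y" if "x \<in> nonadj y" for x y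
    using that by (auto simp: nonadj_def R_def)
  have R_adj: "adj x y" if "x \<in> R" "y \<in> R" "x \<noteq> y" for x y
    using that c_cases[of x] c_cases[of y] by (auto simp: adj_iff R_def)
  have c_adj: "adj y x" if "x \<in> R" "y \<in> {u, v, w}" "c x \<noteq> y" for x y
    using that triangle_verts by (auto simp: adj_iff R_def)
  have plus: "f u * f x * sgn_of G {u, x} = 1" if x: "x \<in> nonadj v" for x
  proof -
    obtain y where y: "y \<in> nonadj v" "y \<noteq> x"
      using card_ge_2_other[OF two] by blast
    \<comment> \<open>Two vertices of \<open>nonadj v\<close> span a \<open>K4\<close> with
      \<open>u\<close> and \<open>w\<close>, and \<open>uw\<close> is positive.\<close>
    have "(f u * f w * sgn_of G {u, w}) * (f w * f x * sgn_of G {w, x}) *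
        (f u * f x * sgn_of G {u, x}) = 1"
      using x y triangle_verts
      by (intro K4_positive[where t = y] val adjs R_adj c_adj) (auto simp: nonadj)
    moreover have "f w * f x * sgn_of G {w, x} = 1"
      using x triangle_verts by (intro pos c_adj) (auto simp: nonadj)
    ultimately show ?thesis
      using uw1 by simp
  qed
  have plus': "f u * f x * sgn_of G {u, x} = 1" if x: "x \<in> nonadj w" for x
  proof -
    obtain p where p: "p \<in> nonadj v"
      using card_ge_2_other[OF two] by blast
    then obtain q where q: "q \<in> nonadj v" "q \<noteq> p"
      using card_ge_2_other[OF two] by blast
    have xpq: "x \<noteq> p" "x \<noteq> q"
      using p q x triangle_verts by (auto simp: nonadj_def)
    have "(f u * f x * sgn_of G {u, x}) * (f x * f p * sgn_of G {x, p}) *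
        (f u * f p * sgn_of G {u, p}) = 1"
      using x p q xpq triangle_verts
      by (intro K4_positive[where t = q] val R_adj c_adj) (auto simp: nonadj)
    moreover have "f x * f p * sgn_of G {x, p} = 1"
      using x p xpq by (intro pos R_adj) (auto simp: nonadj)
    ultimately show ?thesis
      using plus[OF p] by simp
  qed
  show "f u * f x * sgn_of G {u, x} = 1" if "x \<in> nonadj v \<union> nonadj w" for x
    using that plus plus' by blast
  show "card (nonadj w) \<le> 1"
  proof (rule ccontr)
    assume "\<not> ?thesis"
    then have two': "2 \<le> card (nonadj w)"
      by simp
    then obtain x where x: "x \<in> nonadj w"
      using card_ge_2_other[OF two'] by blast
    then obtain y where y: "y \<in> nonadj w" "y \<noteq> x"
      using card_ge_2_other[OF two'] by blast
    \<comment> \<open>Two vertices of \<open>nonadj w\<close> would span a \<open>K4\<close> with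
      \<open>u\<close> and \<open>v\<close>, so \<open>ux\<close> would be negative like
      \<open>uv\<close>, against \<open>plus'\<close>.\<close>
    have "(f u * f v * sgn_of G {u, v}) * (f v * f x * sgn_of G {v, x}) *
        (f u * f x * sgn_of G {u, x}) = 1"
      using x y triangle_verts
      by (intro K4_positive[where t = y] val adjs R_adj c_adj) (auto simp: nonadj)
    moreover have "f v * f x * sgn_of G {v, x} = 1"
      using x triangle_verts by (intro pos c_adj) (auto simp: nonadj)
    ultimately show False
      using uv1 plus'[OF x] by simp
  qed
qed

section \<open>Naming the vertices as in the extremal graphs\<close>

text \<open>\<open>h\<close> and \<open>k\<close> number the fibres of \<open>c\<close> over
  \<open>u\<close> and \<open>v\<close>. The whole fibre over \<open>w\<close> goes to
  \<open>Vw1\<close>, which is injective only if that fibre has at most one element.\<close>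

definition relabel :: "('a \<Rightarrow> nat) \<Rightarrow> ('a \<Rightarrow> nat) \<Rightarrow> 'a \<Rightarrow> vertex" where
  "relabel h k x = (if x = u then Vu else if x = v then Vv else if x = w then Vw
     else if c x = u then Vr (h x) else if c x = v then Vl (k x) else Vw1)"

lemma relabel_simps:
  "relabel h k u = Vu" "relabel h k v = Vv" "relabel h k w = Vw"
  "x \<in> nonadj u \<Longrightarrow> relabel h k x = Vr (h x)"
  "x \<in> nonadj v \<Longrightarrow> relabel h k x = Vl (k x)"
  "x \<in> nonadj w \<Longrightarrow> relabel h k x = Vw1"
  using triangle_verts by (simp_all add: relabel_def nonadj_def R_def)

lemma verts_eq: "verts G = {u, v, w} \<union> (nonadj u \<union> nonadj v \<union> nonadj w)"
  using triangle_verts R_eq by (auto simp: R_def)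

text \<open>The image of \<open>nonadj w\<close> under a constant map is empty or
  \<open>{Vw1}\<close>; this form treats the vertex sets of \<open>G1_shape\<close> and
  \<open>G2_shape\<close> together.\<close>

lemma bij_betw_relabel:
  assumes h: "bij_betw h (nonadj u) {..<p}" and k: "bij_betw k (nonadj v) {..<q}"
    and one: "card (nonadj w) \<le> 1"
  shows "bij_betw (relabel h k) (verts G)
    ({Vu, Vv, Vw} \<union> (\<lambda>_. Vw1) ` nonadj w \<union> Vl ` {..<q} \<union> Vr ` {..<p})"
  unfolding bij_betw_def
proof
  let ?g = "relabel h k"
  have "?g ` nonadj u = Vr ` {..<p}" "?g ` nonadj v = Vl ` {..<q}"
    using h k by (auto simp: bij_betw_def relabel_simps image_iff)
  moreover have "?g ` nonadj w = (\<lambda>_. Vw1) ` nonadj w"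
    by (auto simp: relabel_simps)
  moreover have "?g ` {u, v, w} = {Vu, Vv, Vw}"
    by (simp add: relabel_simps)
  ultimately show "?g ` verts G =
      {Vu, Vv, Vw} \<union> (\<lambda>_. Vw1) ` nonadj w \<union> Vl ` {..<q} \<union> Vr ` {..<p}"
    unfolding verts_eq image_Un by (simp only: Un_ac)
  have hk: "inj_on h (nonadj u)" "inj_on k (nonadj v)"
    using h k by (auto simp: bij_betw_def)
  have w1: "x = y" if "x \<in> nonadj w" "y \<in> nonadj w" for x y
    using one that card_le_Suc0_iff_eq[OF finite_nonadj, of w] by simp
  show "inj_on ?g (verts G)"
  proof (rule inj_onI)
    fix x y assume xy: "x \<in> verts G" "y \<in> verts G" "?g x = ?g y"
    have "x = u \<or> x = v \<or> x = w \<or> x \<in> nonadj u \<or> x \<in> nonadj v \<or> x \<in> nonadj w"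
      "y = u \<or> y = v \<or> y = w \<or> y \<in> nonadj u \<or> y \<in> nonadj v \<or> y \<in> nonadj w"
      using xy(1,2) unfolding verts_eq by blast+
    then show "x = y"
      using xy(3) by (elim disjE)
        (simp_all add: relabel_simps inj_on_eq_iff[OF hk(1)] inj_on_eq_iff[OF hk(2)] w1)
  qed
qed

lemma image_nonedges:
  assumes h: "bij_betw h (nonadj u) {..<p}" and k: "bij_betw k (nonadj v) {..<q}"
  shows "(`) (relabel h k) ` (nsets (verts G) 2 - edges G) =
    (\<lambda>_. {Vw, Vw1}) ` nonadj w \<union> {{Vu, Vr j} | j. j < p} \<union> {{Vv, Vl i} | i. i < q}"
proof -
  have c_simp: "c x = y" if "x \<in> nonadj y" for x y
    using that by (simp add: nonadj_def)
  have "(\<lambda>x. {relabel h k x, relabel h k (c x)}) ` nonadj u = (\<lambda>j. {Vu, Vr j}) ` h ` nonadj u"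
    unfolding image_image by (intro image_cong) (auto simp: relabel_simps c_simp)
  moreover have "(\<lambda>x. {relabel h k x, relabel h k (c x)}) ` nonadj v = (\<lambda>i. {Vv, Vl i}) ` k ` nonadj v"
    unfolding image_image by (intro image_cong) (auto simp: relabel_simps c_simp)
  moreover have "(\<lambda>x. {relabel h k x, relabel h k (c x)}) ` nonadj w = (\<lambda>_. {Vw, Vw1}) ` nonadj w"
    by (intro image_cong) (auto simp: relabel_simps c_simp)
  moreover have "h ` nonadj u = {..<p}" "k ` nonadj v = {..<q}"
    using h k by (auto simp: bij_betw_def)
  moreover have "(`) (relabel h k) ` (nsets (verts G) 2 - edges G) =
      (\<lambda>x. {relabel h k x, relabel h k (c x)}) ` (nonadj u \<union> nonadj v \<union> nonadj w)"
    unfolding nonedges R_def[symmetric] R_eq[symmetric] by (simp add: image_image)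
  ultimately show ?thesis
    unfolding image_Un by auto
qed

text \<open>The neighbours of \<open>u\<close> in \<open>R\<close> are \<open>nonadj v\<close> and
  \<open>nonadj w\<close>. For a normalising \<open>f\<close>, the signs of the edges to them are
  all that remains undetermined.\<close>

definition negative_nbrs :: "('a \<Rightarrow> int) \<Rightarrow> 'a set" where
  "negative_nbrs f = {x \<in> nonadj v \<union> nonadj w. f u * f x * sgn_of G {u, x} = -1}"

text \<open>After switching by \<open>f\<close>, the negative edges are \<open>uv\<close> and those
  from \<open>u\<close> to \<open>negative_nbrs f\<close>. The classification is thus reduced to the
  fibre sizes and this one set.\<close>

lemma switching_equivalent_by_relabelling:
  assumes f: "normalising f"
    and h: "bij_betw h (nonadj u) {..<p}" and k: "bij_betw k (nonadj v) {..<q}"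
    and one: "card (nonadj w) \<le> 1"
  shows "switching_equivalent G (graph_by_complement
    ({Vu, Vv, Vw} \<union> (\<lambda>_. Vw1) ` nonadj w \<union> Vl ` {..<q} \<union> Vr ` {..<p})
    ((\<lambda>_. {Vw, Vw1}) ` nonadj w \<union> {{Vu, Vr j} | j. j < p} \<union> {{Vv, Vl i} | i. i < q})
    (insert {Vu, Vv} ((\<lambda>x. {Vu, relabel h k x}) ` negative_nbrs f)))"
proof -
  have val: "\<And>x. x \<in> verts G \<Longrightarrow> f x \<in> {-1, 1}"
    and pos: "\<And>x y. adj x y \<Longrightarrow> x \<noteq> u \<Longrightarrow> y \<noteq> u \<Longrightarrow> f x * f y * sgn_of G {x, y} = 1"
    and uw1: "f u * f w * sgn_of G {u, w} = 1" and uv1: "f u * f v * sgn_of G {u, v} = -1"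
    using f unfolding normalising_def by auto
  define K where "K = switch {x \<in> verts G. f x = -1} G"
  define N where "N = insert {u, v} ((\<lambda>x. {u, x}) ` negative_nbrs f)"
  have K: "verts K = verts G" "edges K = edges G"
    by (simp_all add: K_def switch_def)
  have mem_N: "{x, y} \<in> N \<longleftrightarrow> (x = u \<and> (y = v \<or> y \<in> negative_nbrs f)) \<or>
      (y = u \<and> (x = v \<or> x \<in> negative_nbrs f))" for x y
    by (auto simp: N_def doubleton_eq_iff)
  have at_u: "f u * f x * sgn_of G {u, x} = (if {u, x} \<in> N then -1 else 1)" if "adj u x" for x
  proof -
    have x: "x \<in> {v, w} \<union> (nonadj v \<union> nonadj w)" "x \<noteq> u"
      using that adj_verts[OF that] verts_eq by (auto simp: adj_iff nonadj_def)
    have "f u * f x * sgn_of G {u, x} = 1 \<or> f u * f x * sgn_of G {u, x} = -1"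
      using val[of u] val[of x] sign_values[OF that] adj_verts[OF that] by auto
    moreover have "v \<notin> negative_nbrs f" "w \<notin> negative_nbrs f" "u \<notin> negative_nbrs f"
      by (auto simp: negative_nbrs_def nonadj_def R_def)
    ultimately show ?thesis
      using x uw1 uv1 triangle_verts unfolding mem_N by (auto simp: negative_nbrs_def)
  qed
  have "isomorphic K (graph_by_complement
    ({Vu, Vv, Vw} \<union> (\<lambda>_. Vw1) ` nonadj w \<union> Vl ` {..<q} \<union> Vr ` {..<p})
    ((`) (relabel h k) ` (nsets (verts G) 2 - edges G)) ((`) (relabel h k) ` N))"
  proof (rule isomorphic_graph_by_complement)
    show "edges K = nsets (verts K) 2 - (nsets (verts G) 2 - edges G)"
      using edges_subset K by auto
    show "nsets (verts G) 2 - edges G \<subseteq> Pow (verts K)"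
      by (auto simp: nsets_def K)
    show "N \<subseteq> Pow (verts K)"
      using triangle_verts by (auto simp: N_def K negative_nbrs_def nonadj_def R_def)
    show "bij_betw (relabel h k) (verts K)
        ({Vu, Vv, Vw} \<union> (\<lambda>_. Vw1) ` nonadj w \<union> Vl ` {..<q} \<union> Vr ` {..<p})"
      unfolding K by (rule bij_betw_relabel[OF h k one])
    fix e assume e: "e \<in> edges K"
    then obtain x y where xy: "e = {x, y}"
      using edges_subset K by (metis nsets2_E subsetD)
    then have adj: "adj x y"
      using e K by (simp add: adj_def)
    have "sgn_of K e = f x * f y * sgn_of G {x, y}"
      unfolding K_def xy using adj_verts[OF adj] by (intro sgn_of_switch val) auto
    also have "\<dots> = (if {x, y} \<in> N then -1 else 1)"
    proof (cases "x = u \<or> y = u")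
      case True
      then show ?thesis
        using at_u[of x] at_u[of y] adj adj_sym[of x y] by (auto simp: insert_commute mult_ac)
    next
      case False
      then show ?thesis
        using pos[OF adj] by (simp add: mem_N)
    qed
    finally show "sgn_of K e = (if e \<in> N then -1 else 1)"
      unfolding xy .
  qed
  moreover have "(`) (relabel h k) ` N =
      insert {Vu, Vv} ((\<lambda>x. {Vu, relabel h k x}) ` negative_nbrs f)"
    by (simp add: N_def image_image relabel_simps)
  ultimately show ?thesis
    unfolding switching_equivalent_def K_def image_nonedges[OF h k] by auto
qed

lemma extremal: "\<exists>H\<in>extremal_family (card (verts G)). switching_equivalent G H"
proof -
  define p q where "p = card (nonadj u)" and "q = card (nonadj v)"
  obtain h k where h: "bij_betw h (nonadj u) {..<p}" and k: "bij_betw k (nonadj v) {..<q}"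
    using ex_bij_betw_finite_nat[OF finite_nonadj, of u] ex_bij_betw_finite_nat[OF finite_nonadj, of v]
    by (auto simp: p_def q_def atLeast0LessThan)
  obtain f where f: "normalising f"
    using normalising_exists by blast
  have le: "card (nonadj w) \<le> q"
    using small by (simp add: q_def nonadj_def R_def)
  have n: "card (verts G) = p + q + card (nonadj w) + 3" "2 \<le> p"
    using card_R card_R_eq large by (simp_all add: p_def q_def nonadj_def R_def)
  \<comment> \<open>For \<open>q\<close> at most 1 this follows from the ordering of the fibres, for
    larger \<open>q\<close> from the copies of \<open>K4\<close> through \<open>u\<close>.\<close>
  have one: "card (nonadj w) \<le> 1"
    using normalising_large(1)[OF f] le by (fastforce simp: q_def)
  have large_q: "negative_nbrs f = {}" if "2 \<le> q"
    using normalising_large(2)[OF f] that by (fastforce simp: negative_nbrs_def q_def)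
  have q_1: "\<exists>x. nonadj v = {x} \<and> k x = 0" if q: "q = 1"
  proof -
    obtain x where "nonadj v = {x}"
      using q card_1_singletonE[of "nonadj v"] unfolding q_def by blast
    moreover have "k x < 1"
      using bij_betwE[OF k] calculation q by auto
    ultimately show ?thesis
      by auto
  qed
  note equiv = switching_equivalent_by_relabelling[OF f h k one]
  show ?thesis
  proof (cases "nonadj w = {}")
    case True
    then have equiv1: "switching_equivalent G
        (G1_shape q p (insert {Vu, Vv} ((\<lambda>x. {Vu, relabel h k x}) ` negative_nbrs f)))"
      using equiv by (simp add: G1_shape_def)
    have n1: "card (verts G) = q + p + 3"
      using n True by simp
    show ?thesis
    proof (cases "negative_nbrs f = {}")
      case True
      then have "switching_equivalent G (G1 q p)"
        using equiv1 by (simp add: G1_def)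
      moreover have "G1 q p \<in> extremal_family (card (verts G))"
        unfolding n1 extremal_family_def by blast
      ultimately show ?thesis
        by blast
    next
      case False
      \<comment> \<open>With both \<open>nonadj v\<close> and \<open>nonadj w\<close> empty,
        \<open>u\<close> would have no neighbours in \<open>R\<close> at all.\<close>
      have "q \<noteq> 0"
        using False \<open>nonadj w = {}\<close> finite_nonadj[of v] by (auto simp: negative_nbrs_def q_def)
      then have q: "q = 1"
        using large_q False by linarith
      then obtain x where x: "nonadj v = {x}" "k x = 0"
        using q_1 by blast
      then have "negative_nbrs f = {x}"
        using False \<open>nonadj w = {}\<close> by (auto simp: negative_nbrs_def)
      moreover have "relabel h k x = Vl 0"
        using x by (simp add: relabel_simps)
      ultimately have "switching_equivalent G (G1' p)"
        using equiv1 q by (simp add: G1'_def)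
      moreover have "G1' p \<in> extremal_family (card (verts G))"
        using q by (simp add: n1 extremal_family_def)
      ultimately show ?thesis
        by blast
    qed
  next
    case False
    then obtain b where b: "nonadj w = {b}"
      using one card_le_Suc0_iff_eq[OF finite_nonadj, of w] by auto
    then have equiv2: "switching_equivalent G
        (G2_shape q p (insert {Vu, Vv} ((\<lambda>x. {Vu, relabel h k x}) ` negative_nbrs f)))"
      using equiv by (simp add: G2_shape_def insert_commute)
    \<comment> \<open>The fibre over \<open>v\<close> is at least as large as the one over
      \<open>w\<close>, which is a singleton here.\<close>
    have n2: "card (verts G) = q + p + 4" and q: "1 \<le> q"
      using n b le by simp_all
    show ?thesis
    proof (cases "negative_nbrs f = {}")
      case True
      then have "switching_equivalent G (G2 q p)"
        using equiv2 by (simp add: G2_def)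
      moreover have "G2 q p \<in> extremal_family (card (verts G))"
        unfolding n2 extremal_family_def using le_trans[OF _ n(2), of 1] q by auto
      ultimately show ?thesis
        by blast
    next
      case False
      then have q: "q = 1"
        using large_q q by linarith
      then obtain x where x: "nonadj v = {x}" "k x = 0"
        using q_1 by blast
      have fam: "G3 p \<in> extremal_family (card (verts G))" "G4 p \<in> extremal_family (card (verts G))"
        "G5 p \<in> extremal_family (card (verts G))"
        using q by (simp_all add: n2 extremal_family_def)
      have label: "relabel h k x = Vl 0" "relabel h k b = Vw1"
        using x b by (simp_all add: relabel_simps)
      \<comment> \<open>The three nonempty subsets correspond to \<open>G3\<close>,
        \<open>G4\<close> and \<open>G5\<close>, with \<open>x\<close> in the role of
        \<open>Vl 0\<close> and \<open>b\<close> in that of \<open>Vw1\<close>.\<close>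
      have "negative_nbrs f \<subseteq> {x, b}"
        using x b by (auto simp: negative_nbrs_def)
      then consider "negative_nbrs f = {x}" | "negative_nbrs f = {b}" | "negative_nbrs f = {b, x}"
        using False by blast
      then show ?thesis
      proof cases
        case 1
        then have "switching_equivalent G (G3 p)"
          using equiv2 label q by (simp add: G3_def)
        then show ?thesis
          using fam by blast
      next
        case 2
        then have "switching_equivalent G (G4 p)"
          using equiv2 label q by (simp add: G4_def)
        then show ?thesis
          using fam by blast
      next
        case 3
        then have "switching_equivalent G (G5 p)"
          using equiv2 label q by (simp add: G5_def)
        then show ?thesis
          using fam by blast
      qed
    qed
  qed
qed

end

section \<open>Edge counts of the extremal graphs\<close>

lemma card_edges_switching_equivalent:
  assumes "signed_graph G" "switching_equivalent G H"
  shows "card (edges H) = card (edges G)"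
proof -
  obtain f where f: "inj_on f (verts G)" "edges H = (`) f ` edges G"
    using assms(2) by (auto simp: switching_equivalent_def isomorphic_def switch_def bij_betw_def)
  have "edges G \<subseteq> Pow (verts G)"
    using assms(1) by (auto simp: signed_graph_def nsets_def)
  then have "inj_on ((`) f) (edges G)"
    using inj_on_image_Pow[OF f(1)] inj_on_subset by blast
  then show ?thesis
    by (simp add: f(2) card_image)
qed

lemma real_choose_2: "real (n choose 2) = real n * (real n - 1) / 2"
  by (induction n) (simp_all add: numeral_2_eq_2 field_simps)

lemma card_edges_graph_by_complement:
  assumes "finite V" "M \<subseteq> nsets V 2"
  shows "card (edges (graph_by_complement V M N)) = (card V choose 2) - card M"
  using assms by (simp add: graph_by_complement_def card_Diff_subset finite_subset
      finite_imp_finite_nsets)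

lemma card_edges_G1_shape:
  "card (edges (G1_shape a b X)) = ((a + b + 3) choose 2) - (a + b)"
proof -
  let ?V = "{Vu, Vv, Vw} \<union> Vl ` {..<a} \<union> Vr ` {..<b}"
  \<comment> \<open>The missing edges are rewritten as injective images, so that they can be
    counted.\<close>
  let ?M = "(\<lambda>j. {Vu, Vr j}) ` {..<b} \<union> (\<lambda>i. {Vv, Vl i}) ` {..<a}"
  have "card ?V = card ({Vu, Vv, Vw} \<union> Vl ` {..<a}) + card (Vr ` {..<b})"
    by (rule card_Un_disjoint) auto
  also have "card ({Vu, Vv, Vw} \<union> Vl ` {..<a}) = card {Vu, Vv, Vw} + card (Vl ` {..<a})"
    by (rule card_Un_disjoint) auto
  finally have V: "card ?V = a + b + 3"
    by (simp add: card_image inj_on_def)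
  have "card ?M = card ((\<lambda>j. {Vu, Vr j}) ` {..<b}) + card ((\<lambda>i. {Vv, Vl i}) ` {..<a})"
    by (rule card_Un_disjoint) (auto simp: doubleton_eq_iff)
  then have M: "card ?M = a + b"
    by (simp add: card_image inj_on_def doubleton_eq_iff)
  have "G1_shape a b X = graph_by_complement ?V ?M X"
    unfolding G1_shape_def by (rule arg_cong3[where f = graph_by_complement]) auto
  moreover have "card (edges (graph_by_complement ?V ?M X)) = (card ?V choose 2) - card ?M"
    by (rule card_edges_graph_by_complement) auto
  ultimately show ?thesis
    by (simp only: V M)
qed

lemma card_edges_G2_shape:
  "card (edges (G2_shape a b X)) = ((a + b + 4) choose 2) - (a + b + 1)"
proof -
  let ?V = "{Vu, Vv, Vw, Vw1} \<union> Vl ` {..<a} \<union> Vr ` {..<b}"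
  let ?M = "{{Vw, Vw1}} \<union> (\<lambda>j. {Vu, Vr j}) ` {..<b} \<union> (\<lambda>i. {Vv, Vl i}) ` {..<a}"
  have "card ?V = card ({Vu, Vv, Vw, Vw1} \<union> Vl ` {..<a}) + card (Vr ` {..<b})"
    by (rule card_Un_disjoint) auto
  also have "card ({Vu, Vv, Vw, Vw1} \<union> Vl ` {..<a}) = card {Vu, Vv, Vw, Vw1} + card (Vl ` {..<a})"
    by (rule card_Un_disjoint) auto
  finally have V: "card ?V = a + b + 4"
    by (simp add: card_image inj_on_def)
  have "card ?M = card ({{Vw, Vw1}} \<union> (\<lambda>j. {Vu, Vr j}) ` {..<b}) +
      card ((\<lambda>i. {Vv, Vl i}) ` {..<a})"
    by (rule card_Un_disjoint) (auto simp: doubleton_eq_iff)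
  also have "card ({{Vw, Vw1}} \<union> (\<lambda>j. {Vu, Vr j}) ` {..<b}) =
      card {{Vw, Vw1}} + card ((\<lambda>j. {Vu, Vr j}) ` {..<b})"
    by (rule card_Un_disjoint) (auto simp: doubleton_eq_iff)
  finally have M: "card ?M = a + b + 1"
    by (simp add: card_image inj_on_def doubleton_eq_iff)
  have "G2_shape a b X = graph_by_complement ?V ?M X"
    unfolding G2_shape_def by (rule arg_cong3[where f = graph_by_complement]) auto
  moreover have "card (edges (graph_by_complement ?V ?M X)) = (card ?V choose 2) - card ?M"
    by (rule card_edges_graph_by_complement) auto
  ultimately show ?thesis
    by (simp only: V M)
qed

text \<open>The choice of negative edges does not affect the count, so only the two shapes matter;
  the bound on \<open>n\<close> keeps \<open>n - 4\<close> and \<open>n - 5\<close> from being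
  truncated.\<close>

lemma card_edges_extremal_family:
  assumes "H \<in> extremal_family n" "7 \<le> n"
  shows "card (edges H) = (n choose 2) - (n - 3)"
proof -
  have "(\<exists>a b X. H = G1_shape a b X \<and> a + b + 3 = n) \<or> (\<exists>a b X. H = G2_shape a b X \<and> a + b + 4 = n)"
  proof -
    have "1 + (n - 4) + 3 = n" "1 + (n - 5) + 4 = n"
      using assms(2) by auto
    then show ?thesis
      using assms(1) unfolding extremal_family_def G1_def G1'_def G2_def G3_def G4_def G5_def
      by (elim UnE insertE) (blast+)?
  qed
  then show ?thesis
    using card_edges_G1_shape card_edges_G2_shape by auto
qed

section \<open>The bound and the case of equality\<close>

lemma balanced_if_triangles_positive:
  assumes G: "signed_graph G"
    and tri: "\<And>x y z. {x, y} \<in> edges G \<Longrightarrow> {y, z} \<in> edges G \<Longrightarrow> {x, z} \<in> edges G \<Longrightarrow>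
      sgn_of G {x, y} * sgn_of G {y, z} * sgn_of G {x, z} = 1"
    and card: "card (nsets (verts G) 2 - edges G) + 3 \<le> card (verts G)"
  shows "balanced G"
proof -
  have E: "edges G \<subseteq> nsets (verts G) 2"
    using G by (simp add: signed_graph_def)
  have "\<exists>f. (\<forall>x\<in>verts G. f x \<in> {-1, 1}) \<and> (\<forall>x\<in>verts G. \<forall>y\<in>verts G. {x, y} \<in> edges G \<longrightarrow>
      sgn_of G {x, y} = f x * f y)"
    using G E tri card by (intro potential_exists) (auto simp: signed_graph_def nsets_def)
  then obtain f where f: "\<And>x. x \<in> verts G \<Longrightarrow> f x \<in> {-1, 1}"
    "\<And>x y. x \<in> verts G \<Longrightarrow> y \<in> verts G \<Longrightarrow> {x, y} \<in> edges G \<Longrightarrow> sgn_of G {x, y} = f x * f y"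
    by blast
  show ?thesis
  proof (rule potential_imp_balanced[OF G f(1)])
    fix x y assume "{x, y} \<in> edges G"
    then show "sgn_of G {x, y} = f x * f y"
      using subsetD[OF E, of "{x, y}"] by (intro f(2)) auto
  qed
qed

lemma unbalanced_negative_triangle:
  assumes G: "signed_graph G" "\<not> balanced G"
    and card: "card (nsets (verts G) 2 - edges G) + 3 \<le> card (verts G)"
  obtains u v w where "{u, v} \<in> edges G" "{v, w} \<in> edges G" "{u, w} \<in> edges G"
    "sgn_of G {u, v} * sgn_of G {v, w} * sgn_of G {u, w} = -1"
proof -
  obtain u v w where E: "{u, v} \<in> edges G" "{v, w} \<in> edges G" "{u, w} \<in> edges G"
    and neg: "sgn_of G {u, v} * sgn_of G {v, w} * sgn_of G {u, w} \<noteq> 1"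
    using balanced_if_triangles_positive[OF G(1) _ card] G(2) by blast
  have "sgn_of G e = 1 \<or> sgn_of G e = -1" if "e \<in> edges G" for e
    using G(1) that by (auto simp: signed_graph_def)
  from this[OF E(1)] this[OF E(2)] this[OF E(3)]
  have "sgn_of G {u, v} * sgn_of G {v, w} * sgn_of G {u, w} = -1"
    using neg by auto
  then show thesis
    using that E by blast
qed

text \<open>With fewer missing edges the graph would contain a negative triangle, and that triangle
  already forces a separate missing edge for each of the other vertices.\<close>

lemma card_nonedges_ge:
  assumes "signed_graph G" "K4_minus_free G" "\<not> balanced G"
  shows "card (verts G) - 3 \<le> card (nsets (verts G) 2 - edges G)"
proof (rule ccontr)
  assume less: "\<not> ?thesis"
  then have "card (nsets (verts G) 2 - edges G) + 3 \<le> card (verts G)"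
    by simp
  then obtain u v w where E: "{u, v} \<in> edges G" "{v, w} \<in> edges G" "{u, w} \<in> edges G"
    "sgn_of G {u, v} * sgn_of G {v, w} * sgn_of G {u, w} = -1"
    using unbalanced_negative_triangle assms by metis
  have "sgn_of G {u, v} * sgn_of G {v, w} * sgn_of G {u, w} \<noteq> 1"
    using E(4) by simp
  then obtain c where "c ` (verts G - {u, v, w}) \<subseteq> {u, v, w}"
    and c: "(\<lambda>x. {x, c x}) ` (verts G - {u, v, w}) \<subseteq> nsets (verts G) 2 - edges G"
      "inj_on (\<lambda>x. {x, c x}) (verts G - {u, v, w})"
    by (rule negative_triangle_nonneighbours[OF assms(1,2) E(1-3)])
  have "finite (nsets (verts G) 2 - edges G)"
    using assms(1) by (simp add: signed_graph_def finite_imp_finite_nsets)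
  then have "card (verts G - {u, v, w}) \<le> card (nsets (verts G) 2 - edges G)"
    using c card_inj_on_le by blast
  moreover have "card (verts G) - card {u, v, w} \<le> card (verts G - {u, v, w})"
    by (intro diff_card_le_card_Diff) simp
  moreover have "card {u, v, w} \<le> 3"
    using card_length[of "[u, v, w]"] by simp
  ultimately show False
    using less by linarith
qed

lemma switching_equivalent_extremal:
  assumes G: "signed_graph G" "K4_minus_free G" "\<not> balanced G"
    and n: "7 \<le> card (verts G)"
    and card: "card (nsets (verts G) 2 - edges G) = card (verts G) - 3"
  shows "\<exists>H\<in>extremal_family (card (verts G)). switching_equivalent G H"
proof -
  have fin: "finite (verts G)"
    using G(1) by (simp add: signed_graph_def)
  have "card (nsets (verts G) 2 - edges G) + 3 \<le> card (verts G)"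
    using card n by simp
  then obtain u v w where E: "{u, v} \<in> edges G" "{v, w} \<in> edges G" "{u, w} \<in> edges G"
    and neg: "sgn_of G {u, v} * sgn_of G {v, w} * sgn_of G {u, w} = -1"
    using unbalanced_negative_triangle G by metis
  have "sgn_of G {u, v} * sgn_of G {v, w} * sgn_of G {u, w} \<noteq> 1"
    using neg by simp
  then obtain c where c: "c ` (verts G - {u, v, w}) \<subseteq> {u, v, w}"
    and sub: "(\<lambda>x. {x, c x}) ` (verts G - {u, v, w}) \<subseteq> nsets (verts G) 2 - edges G"
    and inj: "inj_on (\<lambda>x. {x, c x}) (verts G - {u, v, w})"
    by (rule negative_triangle_nonneighbours[OF G(1,2) E])
  have "edges G \<subseteq> nsets (verts G) 2"
    using G(1) by (simp add: signed_graph_def)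
  then have V: "u \<in> verts G" "v \<in> verts G" "w \<in> verts G" "u \<noteq> v" "v \<noteq> w" "u \<noteq> w"
    using E[THEN subsetD[OF \<open>edges G \<subseteq> nsets (verts G) 2\<close>]] by auto
  then have card_R: "card (verts G - {u, v, w}) = card (verts G) - 3"
    using fin by (simp add: card_Diff_subset)
  \<comment> \<open>The forced missing edges are as many as all missing edges, so the inclusion is
    an equality.\<close>
  have nonedges: "nsets (verts G) 2 - edges G = (\<lambda>x. {x, c x}) ` (verts G - {u, v, w})"
    using card_subset_eq[OF _ sub] fin by (simp add: card card_image[OF inj] card_R
        finite_imp_finite_nsets)
  define N where "N a = card {x \<in> verts G - {u, v, w}. c x = a}" for a
  have "card (verts G - {u, v, w}) \<le> N u + N v + N w"
  proof -
    let ?A = "\<lambda>a. {x \<in> verts G - {u, v, w}. c x = a}"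
    have "verts G - {u, v, w} = ?A u \<union> ?A v \<union> ?A w"
      using c by blast
    then have "card (verts G - {u, v, w}) = card (?A u \<union> ?A v \<union> ?A w)"
      by (rule arg_cong)
    then show ?thesis
      using card_Un_le[of "?A u \<union> ?A v" "?A w"] card_Un_le[of "?A u" "?A v"] unfolding N_def by linarith
  qed
  then have N: "4 \<le> N u + N v + N w"
    using card_R n by linarith
  \<comment> \<open>Apart from the conditions on fibre sizes, the locale assumptions are symmetric
    in the triangle, so its vertices may be permuted.\<close>
  have main: "?thesis" if perm: "{u', v', w'} = {u, v, w}"
    and "{u', v'} \<in> edges G" "{v', w'} \<in> edges G" "{u', w'} \<in> edges G"
    and "sgn_of G {u', v'} * sgn_of G {v', w'} * sgn_of G {u', w'} = -1"
    and "2 \<le> N u'" "N w' \<le> N v'" for u' v' w'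
  proof -
    interpret extremal_triangle G u' v' w' c
      using that(2-) G n c nonedges by unfold_locales (simp_all add: perm N_def)
    show ?thesis
      by (rule extremal)
  qed
  \<comment> \<open>At least four vertices fall into three fibres, so one fibre has two of them; the
    remaining two fibres can be compared.\<close>
  consider "2 \<le> N u" "N w \<le> N v" | "2 \<le> N u" "N v \<le> N w"
    | "2 \<le> N v" "N w \<le> N u" | "2 \<le> N v" "N u \<le> N w"
    | "2 \<le> N w" "N v \<le> N u" | "2 \<le> N w" "N u \<le> N v"
    using N by linarith
  then show ?thesis
  proof cases
    case 1
    with main[of u v w] E neg show ?thesis
      by (simp add: insert_commute mult_ac)
  next
    case 2
    with main[of u w v] E neg show ?thesis
      by (simp add: insert_commute mult_ac)
  next
    case 3
    with main[of v u w] E neg show ?thesis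
      by (simp add: insert_commute mult_ac)
  next
    case 4
    with main[of v w u] E neg show ?thesis
      by (simp add: insert_commute mult_ac)
  next
    case 5
    with main[of w u v] E neg show ?thesis
      by (simp add: insert_commute mult_ac)
  next
    case 6
    with main[of w v u] E neg show ?thesis
      by (simp add: insert_commute mult_ac)
  qed
qed

theorem theorem1p5:
  fixes G :: "'a sgraph" and n :: nat
  assumes "7 \<le> n"
    and "signed_graph G"
    and "card (verts G) = n"
    and "\<not> balanced G"
    and "K4_minus_free G"
  shows "real (card (edges G)) \<le> real n * (real n - 1) / 2 - (real n - 3) \<and>
    (real (card (edges G)) = real n * (real n - 1) / 2 - (real n - 3) \<longleftrightarrow>
       (\<exists>H\<in>extremal_family n. switching_equivalent G H))"
proof -
  let ?M = "nsets (verts G) 2 - edges G"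
  have sub: "edges G \<subseteq> nsets (verts G) 2" and fin: "finite (nsets (verts G) 2)"
    using assms(2) by (auto simp: signed_graph_def finite_imp_finite_nsets)
  have total: "card (edges G) + card ?M = n choose 2"
    using card_mono[OF fin sub] sub fin assms(3)
    by (simp add: card_Diff_subset finite_subset)
  have ge: "n - 3 \<le> card ?M"
    using card_nonedges_ge[of G] assms by simp
  have "(\<exists>H\<in>extremal_family n. switching_equivalent G H) \<longleftrightarrow> card ?M = n - 3"
  proof
    assume "card ?M = n - 3"
    then show "\<exists>H\<in>extremal_family n. switching_equivalent G H"
      using switching_equivalent_extremal[of G] assms by simp
  next
    assume "\<exists>H\<in>extremal_family n. switching_equivalent G H"
    then have "card (edges G) = (n choose 2) - (n - 3)"
      using card_edges_switching_equivalent[OF assms(2)] card_edges_extremal_family[OF _ assms(1)]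
      by metis
    \<comment> \<open>\<open>ge\<close> rules out that the subtraction in the edge count is
      truncated.\<close>
    then show "card ?M = n - 3"
      using total ge by linarith
  qed
  moreover have "real (card (edges G)) + real (card ?M) = real n * (real n - 1) / 2"
    using total real_choose_2[of n] by (metis of_nat_add)
  moreover have "real n - 3 \<le> real (card ?M)" "card ?M = n - 3 \<longleftrightarrow> real (card ?M) = real n - 3"
    using ge assms(1) by linarith+
  ultimately show ?thesis
    by auto
qed

end
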